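(* Let $\mathcal{H}\subseteq\mathcal{B}$, $L:\mathcal{B}\to\mathbb{R}$ and $\nabla L:\mathcal{B}\to\mathcal{B}$ be as in the context, and suppose conditions (Smooth), (Descent) and (Compat) of the context hold with constants $K,\alpha,\beta>0$. Assume there is $L^\star\in\mathbb{R}$ with $L(f)\ge L^\star$ for all $f\in\mathcal{B}$. Let $T\ge1$, $\eta>0$, $f_0\in\mathcal{B}$, $g_0,\dots,g_{T-1}\in\mathcal{B}$ and $f_{t+1}=f_t-\eta g_t$ for $t=0,\dots,T-1$. Assume that for some constant $0\le\epsilon<\min\{1/2,\ \alpha/(\alpha+\beta)\}$, $$\mathrm{RelErr}(g_t,\nabla L(f_t))\le\epsilon\qquad\text{for all }t=0,\dots,T-1 .$$ Then, for any learning rate $\eta<\dfrac{2(\alpha-(\alpha+\beta)\epsilon)}{K(2\epsilon+1)}$, $$\min_{t=0,\dots,T-1}\lVert\nabla L(f_t)\rVert_{\mathcal{B}}^2\le\frac{L(f_0)-L^\star}{T\,\eta\, r},\qquad\text{where } r:=\alpha-\frac{K\eta}{2}-\Bigl(\beta+\frac32K\eta\Bigr)\frac{\epsilon}{1-\epsilon}>0 .$$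
   Context: $\mathcal{H}$ is a real Hilbert space contained (as a linear subspace) in a real Banach space $\mathcal{B}$, with dual $\mathcal{B}^*$ and dual norm $\lVert u\rVert_{\mathcal{B}^*}=\sup_{\lVert b\rVert_{\mathcal{B}}\le1}|u(b)|$. One is given a Fréchet differentiable loss on $\mathcal{H}$, with Riesz gradient operator $\mathcal{H}\to\mathcal{H}$ characterized by: the derivative at $f$ in direction $v$ equals $\langle \nabla L(f),v\rangle_{\mathcal{H}}$ for all $v\in\mathcal{H}$. It is assumed that the loss extends to a Fréchet differentiable functional $L:\mathcal{B}\to\mathbb{R}$, and that the gradient operator extends to an operator $\nabla L:\mathcal{B}\to\mathcal{B}$ (each extension agrees with the original on $\mathcal{H}$; the same symbols are used for the extensions). $\mathrm{D}L(f;v)$ denotes the derivative of the extended $L$ at $f\in\mathcal{B}$ in direction $v\in\mathcal{B}$, and $\mathrm{D}L(f;\cdot)\in\mathcal{B}^*$. Relative error: $\mathrm{RelErr}(g,\nabla L(f)):=\lVert g-\nabla L(f)\rVert_{\mathcal{B}}/\lVert g\rVert_{\mathcal{B}}$, with conventions $0/0=0$ and $a/0=+\infty$ for $a>0$. The conditions referred to (with constants $K,\alpha,\beta>0$): - (Smooth) $L(f)\le L(f')+\mathrm{D}L(f';f-f')+\frac K2\lVert f-f'\rVert_{\mathcal{B}}^2$ for all $f,f'\in\mathcal{B}$. - (Descent) $\mathrm{D}L(f;\nabla L(f))\ge\alpha\lVert\nabla L(f)\rVert_{\mathcal{B}}^2$ for all $f\in\mathcal{B}$. - (Compat) $\lVert\mathrm{D}L(f;\cdot)\rVert_{\mathcal{B}^*}\le\beta\lVert\nabla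 L(f)\rVert_{\mathcal{B}}$ for all $f\in\mathcal{B}$. *)

theory Defs
  imports "HOL-Analysis.Analysis"
begin

definition dual_norm :: "('b::real_normed_vector \<Rightarrow> real) \<Rightarrow> real" where
  "dual_norm u = (SUP b\<in>{b. norm b \<le> 1}. \<bar>u b\<bar>)"

lemma dual_norm_eq_onorm:
  fixes u :: "'b::real_normed_vector \<Rightarrow> real"
  assumes "bounded_linear u"
  shows "dual_norm u = onorm u"
proof -
  interpret u: bounded_linear u by fact
  have le: "\<bar>u b\<bar> \<le> onorm u * norm b" for b
    using onorm[OF assms, of b] by simp
  have ub: "\<bar>u b\<bar> \<le> onorm u" if "norm b \<le> 1" for b
    using order_trans[OF le[of b] mult_left_le[OF that onorm_pos_le[OF assms]]] .
  have bdd: "bdd_above ((\<lambda>b. \<bar>u b\<bar>) ` {b. norm b \<le> 1})"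
    using ub by (intro bdd_aboveI2) auto
  have mem: "\<bar>u b\<bar> \<le> dual_norm u" if "norm b \<le> 1" for b
    unfolding dual_norm_def by (rule cSUP_upper[OF _ bdd]) (use that in simp)
  have "onorm u \<le> dual_norm u"
  proof (rule onorm_bound)
    show "0 \<le> dual_norm u" using mem[of 0] by simp
    show "norm (u x) \<le> dual_norm u * norm x" for x
    proof (cases "x = 0")
      case False
      have "\<bar>u (x /\<^sub>R norm x)\<bar> \<le> dual_norm u" using False by (intro mem) simp
      then show ?thesis using False by (simp add: u.scaleR abs_mult field_simps)
    qed (simp add: u.zero)
  qed
  moreover have "dual_norm u \<le> onorm u"
    unfolding dual_norm_def by (rule cSUP_least) (auto intro: ub exI[of _ 0])
  ultimately show ?thesis by simp
qed

text \<open>Division on \<^typ>\<open>ereal\<close> has the conventions \<open>0 / 0 = 0\<close> and \<open>a / 0 = \<infinity>\<close> for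
  \<open>a > 0\<close> built in; \<open>rel_err_zero\<close> below records this.\<close>

definition rel_err :: "'b::real_normed_vector \<Rightarrow> 'b \<Rightarrow> ereal" where
  "rel_err g w = ereal (norm (g - w)) / ereal (norm g)"

lemma rel_err_nonzero: "g \<noteq> 0 \<Longrightarrow> rel_err g w = ereal (norm (g - w) / norm g)"
  by (simp add: rel_err_def)

lemma rel_err_zero: "rel_err 0 w = (if w = 0 then 0 else \<infinity>)"
  by (simp add: rel_err_def divide_ereal_def)

end

theory Submission
  imports Defs
begin

text \<open>The relative error bound \<open>\<parallel>g - \<nabla>L(f)\<parallel> \<le> \<epsilon> \<parallel>g\<parallel>\<close> gives
  \<open>\<parallel>g - \<nabla>L(f)\<parallel> \<le> \<delta> \<parallel>\<nabla>L(f)\<parallel>\<close> with \<open>\<delta> = \<epsilon> / (1 - \<epsilon>) \<le> 1\<close>, so replacing \<open>\<nabla>L(f)\<close> by \<open>g\<close>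
  costs at most \<open>\<beta> \<delta> \<parallel>\<nabla>L(f)\<parallel>\<^sup>2\<close> in the first-order term of (Smooth), and
  \<open>(1 + \<delta>)\<^sup>2 \<le> 1 + 3 \<delta>\<close> controls the second-order term. Hence every step decreases the loss
  by at least \<open>\<eta> r \<parallel>\<nabla>L(f)\<parallel>\<^sup>2\<close>; telescope and bound the minimum by the mean.\<close>

text \<open>For \<open>g = 0\<close> the relative error is \<open>0\<close> or
  \<open>\<infinity>\<close>. A real bound excludes \<open>\<infinity>\<close>, so
  \<open>w = 0\<close> and both sides vanish.\<close>

lemma rel_err_le_ereal_imp_norm_le:
  assumes "rel_err g w \<le> ereal \<epsilon>"
  shows "norm (g - w) \<le> \<epsilon> * norm g"
proof (cases "g = 0")
  case True
  then show ?thesis using assms by (simp add: rel_err_zero split: if_splits)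
next
  case False
  then show ?thesis using assms by (simp add: rel_err_nonzero field_simps)
qed

text \<open>Trades the scale \<open>norm g\<close> for \<open>norm w\<close>: the triangle
  inequality bounds \<open>norm g\<close>, and the resulting term
  \<open>\<epsilon> * norm (g - w)\<close> is absorbed on the left since
  \<open>\<epsilon> < 1\<close>.\<close>

lemma norm_diff_le_of_relative_error:
  fixes g w :: "'b::real_normed_vector"
  assumes "norm (g - w) \<le> \<epsilon> * norm g" "0 \<le> \<epsilon>" "\<epsilon> < 1"
  shows "norm (g - w) \<le> \<epsilon> / (1 - \<epsilon>) * norm w"
proof -
  have "norm g \<le> norm (g - w) + norm w"
    using norm_triangle_ineq[of "g - w" w] by simp
  then have "\<epsilon> * norm g \<le> \<epsilon> * (norm (g - w) + norm w)"
    using assms(2) by (rule mult_left_mono)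
  then have "norm (g - w) * (1 - \<epsilon>) \<le> \<epsilon> * norm w"
    using assms(1) by (simp add: algebra_simps)
  then show ?thesis using assms(3) by (simp add: field_simps)
qed

lemma abs_le_dual_norm_mult:
  assumes "bounded_linear u"
  shows "\<bar>u x\<bar> \<le> dual_norm u * norm x"
  using onorm[OF assms, of x] by (simp add: dual_norm_eq_onorm[OF assms])

lemma inexact_gradient_step_decrease:
  fixes L :: "'b::real_normed_vector \<Rightarrow> real" and x w g :: 'b
  assumes D: "bounded_linear D"
    and smooth: "L (x - \<eta> *\<^sub>R g) \<le> L x + D (- (\<eta> *\<^sub>R g)) + K / 2 * (norm (\<eta> *\<^sub>R g))\<^sup>2"
    and descent: "\<alpha> * (norm w)\<^sup>2 \<le> D w"
    and compat: "dual_norm D \<le> \<beta> * norm w"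
    and err: "norm (g - w) \<le> \<delta> * norm w"
    and nonneg: "0 \<le> \<eta>" "0 \<le> K" "0 \<le> \<beta>" and \<delta>: "0 \<le> \<delta>" "\<delta> \<le> 1"
  shows "\<eta> * (\<alpha> - K * \<eta> / 2 - (\<beta> + 3 / 2 * K * \<eta>) * \<delta>) * (norm w)\<^sup>2 \<le> L x - L (x - \<eta> *\<^sub>R g)"
proof -
  interpret D: bounded_linear D by fact
  have "\<bar>D (g - w)\<bar> \<le> dual_norm D * norm (g - w)"
    by (rule abs_le_dual_norm_mult[OF D])
  also have "\<dots> \<le> (\<beta> * norm w) * (\<delta> * norm w)"
    using compat err nonneg(3) by (intro mult_mono) auto
  \<comment> \<open>Split \<open>D g = D w + D (g - w)\<close>: descent bounds the first summand
    below, and the second has just been bounded in absolute value.\<close>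
  finally have "D g \<ge> (\<alpha> - \<beta> * \<delta>) * (norm w)\<^sup>2"
    using descent by (simp add: D.diff power2_eq_square algebra_simps)
  then have first: "\<eta> * ((\<alpha> - \<beta> * \<delta>) * (norm w)\<^sup>2) \<le> \<eta> * D g"
    using nonneg(1) by (rule mult_left_mono)
  have "norm g \<le> (1 + \<delta>) * norm w"
    using norm_triangle_ineq[of "g - w" w] err by (simp add: algebra_simps)
  then have "(norm g)\<^sup>2 \<le> (1 + \<delta>)\<^sup>2 * (norm w)\<^sup>2"
    by (metis norm_ge_zero power_mono power_mult_distrib)
  \<comment> \<open>From \<open>\<delta> \<le> 1\<close> follows
    \<open>\<delta> * \<delta> \<le> \<delta>\<close>. This keeps the bound linear in \<delta> and
    produces the coefficient \<open>3 / 2 * K * \<eta>\<close>.\<close>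
  also have "\<dots> \<le> (1 + 3 * \<delta>) * (norm w)\<^sup>2"
    using mult_left_mono[OF \<delta>(2) \<delta>(1)]
    by (intro mult_right_mono) (simp_all add: power2_eq_square algebra_simps)
  finally have second: "K / 2 * \<eta>\<^sup>2 * (norm g)\<^sup>2 \<le> K / 2 * \<eta>\<^sup>2 * ((1 + 3 * \<delta>) * (norm w)\<^sup>2)"
    using nonneg(2) by (intro mult_left_mono) simp_all
  have "L (x - \<eta> *\<^sub>R g) \<le> L x - \<eta> * D g + K / 2 * \<eta>\<^sup>2 * (norm g)\<^sup>2"
    using smooth by (simp add: D.neg D.scaleR power_mult_distrib)
  with first second show ?thesis
    by (simp add: power2_eq_square algebra_simps)
qed

text \<open>The minimum is at most the mean, and the decreases of \<open>V\<close> telescope; only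
  the final value \<open>V T\<close> has to be bounded below.\<close>

lemma Min_le_telescoping_decrease:
  fixes a V :: "nat \<Rightarrow> real"
  assumes "\<And>t. t < T \<Longrightarrow> c * a t \<le> V t - V (Suc t)" "m \<le> V T" "c > 0" "T \<ge> 1"
  shows "(MIN t\<in>{..<T}. a t) \<le> (V 0 - m) / (real T * c)"
proof -
  let ?M = "MIN t\<in>{..<T}. a t"
  have "real T * (c * ?M) = (\<Sum>t<T. c * ?M)"
    by simp
  also have "\<dots> \<le> (\<Sum>t<T. c * a t)"
    using assms(3) by (intro sum_mono mult_left_mono Min_le) auto
  also have "\<dots> \<le> (\<Sum>t<T. V t - V (Suc t))"
    using assms(1) by (intro sum_mono) auto
  also have "\<dots> = V 0 - V T"
    by (rule sum_lessThan_telescope')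
  finally show ?thesis
    using assms(2-4) by (simp add: field_simps)
qed

theorem proposition3p6:
  fixes emb :: "'h::{real_inner, complete_space} \<Rightarrow> 'b::banach"
    and lossH :: "'h \<Rightarrow> real" and gradH :: "'h \<Rightarrow> 'h"
    and L :: "'b \<Rightarrow> real" and gradL :: "'b \<Rightarrow> 'b"
    and K \<alpha> \<beta> \<eta> \<epsilon> Lstar :: real
    and T :: nat and f g :: "nat \<Rightarrow> 'b"
  assumes embedding: "linear emb" "inj emb"
    and riesz_gradient:
      "\<And>h. (lossH has_derivative (\<lambda>v. inner (gradH h) v)) (at h)"
    and L_extends: "\<And>h. L (emb h) = lossH h"
    and L_differentiable: "\<And>x. L differentiable (at x)"
    and gradL_extends: "\<And>h. gradL (emb h) = emb (gradH h)"
    and constants_pos: "K > 0" "\<alpha> > 0" "\<beta> > 0"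
    and Smooth: "\<And>x y. L x \<le> L y + frechet_derivative L (at y) (x - y) + K / 2 * (norm (x - y))\<^sup>2"
    and Descent: "\<And>x. frechet_derivative L (at x) (gradL x) \<ge> \<alpha> * (norm (gradL x))\<^sup>2"
    and Compat: "\<And>x. dual_norm (frechet_derivative L (at x)) \<le> \<beta> * norm (gradL x)"
    and lower_bound: "\<And>x. L x \<ge> Lstar"
    and T_ge_1: "T \<ge> 1"
    and \<eta>_pos: "\<eta> > 0"
    and step: "\<And>t. t < T \<Longrightarrow> f (Suc t) = f t - \<eta> *\<^sub>R g t"
    and \<epsilon>_bounds: "0 \<le> \<epsilon>" "\<epsilon> < min (1 / 2) (\<alpha> / (\<alpha> + \<beta>))"
    and rel_err_bound: "\<And>t. t < T \<Longrightarrow> rel_err (g t) (gradL (f t)) \<le> ereal \<epsilon>"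
    and \<eta>_bound: "\<eta> < 2 * (\<alpha> - (\<alpha> + \<beta>) * \<epsilon>) / (K * (2 * \<epsilon> + 1))"
  shows "let r = \<alpha> - K * \<eta> / 2 - (\<beta> + 3 / 2 * K * \<eta>) * (\<epsilon> / (1 - \<epsilon>))
         in r > 0 \<and>
            (MIN t\<in>{..<T}. (norm (gradL (f t)))\<^sup>2) \<le> (L (f 0) - Lstar) / (real T * \<eta> * r)"
proof -
  define \<delta> where "\<delta> = \<epsilon> / (1 - \<epsilon>)"
  define r where "r = \<alpha> - K * \<eta> / 2 - (\<beta> + 3 / 2 * K * \<eta>) * \<delta>"
  have \<epsilon>: "0 \<le> \<epsilon>" "\<epsilon> < 1 / 2"
    using \<epsilon>_bounds by auto
  \<comment> \<open>\<open>\<delta> \<le> 1\<close> amounts to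
    \<open>\<epsilon> \<le> 1 / 2\<close>.\<close>
  then have \<delta>: "0 \<le> \<delta>" "\<delta> \<le> 1"
    by (auto simp: \<delta>_def field_simps)
  have "0 < K * (2 * \<epsilon> + 1)"
    using constants_pos \<epsilon> by simp
  with \<eta>_bound have "\<eta> * (K * (2 * \<epsilon> + 1)) < 2 * (\<alpha> - (\<alpha> + \<beta>) * \<epsilon>)"
    by (simp add: pos_less_divide_eq)
  \<comment> \<open>Clearing the denominator of \<delta>, the coefficient of
    \<open>K * \<eta>\<close> is \<open>(1 - \<epsilon>) / 2 + 3 * \<epsilon> / 2 = (2 * \<epsilon>
    + 1) / 2\<close>. So the step size bound says exactly that \<open>r\<close> is positive.\<close>
  moreover have "r * (1 - \<epsilon>) = \<alpha> - (\<alpha> + \<beta>) * \<epsilon> - \<eta> * (K * (2 * \<epsilon> + 1)) / 2"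
  proof -
    have "\<delta> * (1 - \<epsilon>) = \<epsilon>"
      using \<epsilon> by (simp add: \<delta>_def)
    then have "r * (1 - \<epsilon>) = (\<alpha> - K * \<eta> / 2) * (1 - \<epsilon>) - (\<beta> + 3 / 2 * K * \<eta>) * \<epsilon>"
      unfolding r_def by (simp add: left_diff_distrib mult.assoc)
    then show ?thesis
      by (simp add: field_simps)
  qed
  ultimately have "0 < r * (1 - \<epsilon>)"
    by simp
  then have r: "r > 0"
    using \<epsilon> by (simp add: zero_less_mult_iff)
  have decrease: "\<eta> * r * (norm (gradL (f t)))\<^sup>2 \<le> L (f t) - L (f (Suc t))" if t: "t < T" for t
    unfolding step[OF t] r_def
  proof (rule inexact_gradient_step_decrease)
    show "bounded_linear (frechet_derivative L (at (f t)))"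
      using L_differentiable frechet_derivative_works has_derivative_bounded_linear by blast
    show "norm (g t - gradL (f t)) \<le> \<delta> * norm (gradL (f t))"
      unfolding \<delta>_def
      using rel_err_le_ereal_imp_norm_le[OF rel_err_bound[OF t]] \<epsilon>
      by (intro norm_diff_le_of_relative_error) auto
    show "L (f t - \<eta> *\<^sub>R g t) \<le> L (f t) + frechet_derivative L (at (f t)) (- (\<eta> *\<^sub>R g t))
        + K / 2 * (norm (\<eta> *\<^sub>R g t))\<^sup>2"
      using Smooth[of "f t - \<eta> *\<^sub>R g t" "f t"] by simp
  qed (use Descent Compat constants_pos \<eta>_pos \<delta> in auto)
  \<comment> \<open>Telescoping with \<open>V\<close> the loss along the iterates,
    \<open>c = \<eta> * r\<close> and \<open>m = Lstar\<close>.\<close>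
  have "(MIN t\<in>{..<T}. (norm (gradL (f t)))\<^sup>2) \<le> (L (f 0) - Lstar) / (real T * (\<eta> * r))"
    using decrease lower_bound \<eta>_pos r T_ge_1
    by (intro Min_le_telescoping_decrease[where V = "\<lambda>t. L (f t)"]) auto
  with r show ?thesis
    by (simp add: Let_def r_def \<delta>_def mult.assoc)
qed

end
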